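(* Fix a dimension $m\ge1$ and let $\epsilon>0$. Then there exists $\delta>0$ such that $$|Ax-Bx|\le\epsilon|Bx|\qquad\text{for all }x\in\mathbf{R}^m,$$ for any positive linear operators $A,B:\mathbf{R}^m\to\mathbf{R}^m$ which satisfy $$\big||Ax|-|Bx|\big|\le\delta|Bx|\qquad\text{for all }x\in\mathbf{R}^m.$$
   Context: $|\cdot|$ denotes the Euclidean norm on $\mathbf{R}^m$. A positive linear operator on $\mathbf{R}^m$ is a symmetric (self-adjoint) positive definite one. *)

theory Defs
  imports "HOL-Analysis.Analysis"
begin

definition positive_operator :: "(real ^ 'm \<Rightarrow> real ^ 'm) \<Rightarrow> bool" where
  "positive_operator A \<longleftrightarrow>
     linear A \<and> (\<forall>x y. A x \<bullet> y = x \<bullet> A y) \<and> (\<forall>x. x \<noteq> 0 \<longrightarrow> A x \<bullet> x > 0)"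

end

theory Submission
  imports Defs
begin

text \<open>
  Put \<open>T = A B\<^sup>-\<^sup>1\<close>. The hypothesis says that \<open>T\<close> distorts norms by a factor in \<open>[1 - \<delta>, 1 + \<delta>]\<close>,
  and the claim is that \<open>T\<close> is close to the identity. The squared Frobenius norm of \<open>T - 1\<close> is
  \<open>tr (T\<^sup>T T) - 2 tr T + m\<close>, where \<open>tr (T\<^sup>T T) \<le> m (1 + \<delta>)\<^sup>2\<close>, so a lower bound on \<open>tr T\<close> suffices.
  Writing \<open>B\<^sup>-\<^sup>1 = V V\<^sup>T\<close>, the matrix \<open>T = A V V\<^sup>T\<close> has the trace and determinant of the positive definite
  matrix \<open>V\<^sup>T A V\<close>, so the inequality of arithmetic and geometric means for the eigenvalues of the latter gives
  \<open>tr T \<ge> m (det T)\<^bsup>1/m\<^esup> \<ge> m (1 - \<delta>)\<close>.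
\<close>

section \<open>Diagonalization of symmetric matrices\<close>

text \<open>The quadratic form \<open>f x \<bullet> x\<close> attains a maximum \<open>c\<close> on
  the unit sphere of \<open>U\<close>, at \<open>e\<close>. The residual
  \<open>w = f e - c e\<close> is orthogonal to \<open>e\<close>, and a small move from
  \<open>e\<close> along \<open>w\<close> would push the Rayleigh quotient above \<open>c\<close>
  unless \<open>w = 0\<close>.\<close>

lemma selfadjoint_eigenvector_exists:
  fixes f :: "'a::euclidean_space \<Rightarrow> 'a"
  assumes lin: "linear f" and sym: "\<And>x y. f x \<bullet> y = x \<bullet> f y"
    and sub: "subspace U" and inv: "f ` U \<subseteq> U" and nontriv: "z \<in> U" "z \<noteq> 0"
  obtains e c where "e \<in> U" "norm e = 1" "f e = c *\<^sub>R e"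
proof -
  let ?K = "sphere 0 1 \<inter> U"
  have "compact ?K"
    by (intro compact_Int_closed compact_sphere closed_subspace sub)
  moreover have "z /\<^sub>R norm z \<in> ?K"
    using nontriv sub by (simp add: subspace_scale)
  moreover have "continuous_on ?K (\<lambda>x. f x \<bullet> x)"
    using lin by (intro continuous_intros linear_continuous_on) (simp add: linear_linear)
  ultimately obtain e where e: "e \<in> ?K" and max: "\<And>y. y \<in> ?K \<Longrightarrow> f y \<bullet> y \<le> f e \<bullet> e"
    using continuous_attains_sup[of ?K "\<lambda>x. f x \<bullet> x"] by blast
  define c where "c = f e \<bullet> e"
  have ee: "e \<bullet> e = 1" and eU: "e \<in> U" using e by (auto simp: dot_square_norm)
  have bound: "f v \<bullet> v \<le> c * (v \<bullet> v)" if "v \<in> U" for v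
  proof (cases "v = 0")
    case False
    then have "f (v /\<^sub>R norm v) \<bullet> (v /\<^sub>R norm v) \<le> c"
      unfolding c_def using that sub by (intro max) (simp add: subspace_scale)
    then have "(f v \<bullet> v) / (norm v)\<^sup>2 \<le> c"
      by (simp add: linear_scale[OF lin] power2_eq_square divide_inverse mult_ac)
    then show ?thesis
      using False by (simp add: divide_simps dot_square_norm split: if_splits)
  qed (simp add: linear_0[OF lin])
  define w where "w = f e - c *\<^sub>R e"
  have wU: "w \<in> U"
    unfolding w_def using eU inv sub by (auto intro!: subspace_diff subspace_scale)
  have ew: "e \<bullet> w = 0"
    unfolding w_def using ee by (simp add: inner_diff_right c_def inner_commute)
  have fw: "f e \<bullet> w = w \<bullet> w"
    using ew by (simp add: w_def inner_diff_left)
  \<comment> \<open>The step length \<open>t\<close> is chosen so that in the bound at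
    \<open>e + t w\<close> the quadratic term, at most \<open>t\<^sup>2 * k\<close>, is only half of
    the linear term \<open>2 * t * (w \<bullet> w)\<close>. The summand 1 keeps the denominator
    positive.\<close>
  define k where "k = \<bar>c * (w \<bullet> w) - f w \<bullet> w\<bar> + 1"
  have k: "k > 0" by (simp add: k_def)
  define t where "t = (w \<bullet> w) / k"
  have "e + t *\<^sub>R w \<in> U"
    using eU wU sub by (intro subspace_add subspace_scale)
  from bound[OF this] have "2 * t * (w \<bullet> w) \<le> t\<^sup>2 * (c * (w \<bullet> w) - f w \<bullet> w)"
    using sym[of e w] ew fw ee
    by (simp add: linear_add[OF lin] linear_scale[OF lin] inner_add_left inner_add_right c_def
        inner_commute algebra_simps power2_eq_square)
  also have "\<dots> \<le> t\<^sup>2 * k"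
    by (intro mult_left_mono) (auto simp: k_def)
  also have "\<dots> = t * (w \<bullet> w)" using k by (simp add: t_def power2_eq_square)
  finally have "t * (w \<bullet> w) \<le> 0" by simp
  moreover have "t * (w \<bullet> w) = (w \<bullet> w)\<^sup>2 / k" by (simp add: t_def power2_eq_square)
  ultimately have "(w \<bullet> w)\<^sup>2 \<le> 0" using k by (simp add: divide_le_0_iff)
  then have "f e = c *\<^sub>R e" by (simp add: w_def)
  then show ?thesis using that eU e by auto
qed

text \<open>Induction on \<open>k\<close>: the orthogonal complement of the eigenvectors found so
  far is invariant, because self-adjointness moves \<open>f\<close> onto an eigenvector, and it is
  nonzero as long as fewer than \<open>DIM('a)\<close> have been found.\<close>

lemma selfadjoint_orthonormal_eigenvectors:
  fixes f :: "'a::euclidean_space \<Rightarrow> 'a"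
  assumes lin: "linear f" and sym: "\<And>x y. f x \<bullet> y = x \<bullet> f y" and "k \<le> DIM('a)"
  shows "\<exists>E. finite E \<and> card E = k \<and> pairwise orthogonal E \<and>
             (\<forall>e\<in>E. norm e = 1 \<and> (\<exists>c. f e = c *\<^sub>R e))"
  using assms(3)
proof (induction k)
  case (Suc k)
  then obtain E where E: "finite E" "card E = k" "pairwise orthogonal E"
    "\<And>e. e \<in> E \<Longrightarrow> norm e = 1" "\<And>e. e \<in> E \<Longrightarrow> \<exists>c. f e = c *\<^sub>R e"
    by auto
  have "dim E < DIM('a)"
    using dim_le_card'[OF E(1)] E(2) Suc.prems by linarith
  then obtain z where z: "z \<noteq> 0" "\<And>y. y \<in> span E \<Longrightarrow> orthogonal z y"
    by (rule orthogonal_to_subspace_exists) metis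
  define U where "U = {x. \<forall>e\<in>E. x \<bullet> e = 0}"
  have "subspace U" by (auto simp: U_def subspace_def inner_add_left)
  moreover have "f ` U \<subseteq> U"
  proof clarify
    fix x assume x: "x \<in> U"
    have "f x \<bullet> e = 0" if "e \<in> E" for e
    proof -
      obtain c where "f e = c *\<^sub>R e" using E(5) \<open>e \<in> E\<close> by blast
      then show ?thesis using x \<open>e \<in> E\<close> by (simp add: sym U_def)
    qed
    then show "f x \<in> U" by (simp add: U_def)
  qed
  moreover have "z \<in> U" using z(2) by (auto simp: U_def orthogonal_def span_base)
  ultimately obtain e c where e: "e \<in> U" "norm e = 1" "f e = c *\<^sub>R e"
    using selfadjoint_eigenvector_exists[OF lin sym] z(1) by metis
  have "e \<notin> E" using e by (auto simp: U_def)
  moreover have "pairwise orthogonal (insert e E)"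
    using E(3) e(1) by (auto simp: pairwise_insert U_def orthogonal_def inner_commute)
  ultimately have "finite (insert e E) \<and> card (insert e E) = Suc k \<and>
      pairwise orthogonal (insert e E) \<and>
      (\<forall>e\<in>insert e E. norm e = 1 \<and> (\<exists>c. f e = c *\<^sub>R e))"
    using E e by auto
  then show ?case by blast
qed (auto intro: exI[of _ "{}"])

lemma inner_matrix_vector_transpose:
  fixes M :: "real^'n^'m"
  shows "(M *v x) \<bullet> y = x \<bullet> (transpose M *v y)"
  by (metis dot_lmul_matrix inner_commute transpose_matrix_vector transpose_transpose)

text \<open>The columns of \<open>P\<close> are an orthonormal eigenbasis of \<open>S\<close>,
  enumerated by the index type, and \<open>d\<close> lists the eigenvalues.\<close>

lemma symmetric_matrix_diagonalizable:
  fixes S :: "real^'n^'n"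
  assumes "transpose S = S"
  obtains P d where "orthogonal_matrix P"
    "transpose P ** S ** P = (\<chi> i j. if i = j then d i else 0)"
proof -
  obtain E :: "(real^'n) set" where E: "finite E" "card E = CARD('n)" "pairwise orthogonal E"
    "\<And>e. e \<in> E \<Longrightarrow> norm e = 1" "\<And>e. e \<in> E \<Longrightarrow> \<exists>c. S *v e = c *\<^sub>R e"
    using selfadjoint_orthonormal_eigenvectors[of "(*v) S" "CARD('n)"] assms
    by (auto simp: inner_matrix_vector_transpose)
  obtain p where p: "bij_betw p (UNIV :: 'n set) E"
    using E(1,2) finite_same_card_bij[of "UNIV :: 'n set" E] by auto
  have pE: "p i \<in> E" for i using p by (auto simp: bij_betw_def)
  have "\<exists>c. S *v p i = c *\<^sub>R p i" for i using E(5) pE by blast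
  then obtain d where d: "\<And>i. S *v p i = d i *\<^sub>R p i" by metis
  have orth: "p i \<bullet> p j = (if i = j then 1 else 0)" for i j
  proof (cases "i = j")
    case False
    then have "p i \<noteq> p j" using p by (auto simp: bij_betw_def inj_on_def)
    then show ?thesis using E(3) pE False by (auto simp: pairwise_def orthogonal_def)
  qed (use E(4) pE in \<open>simp add: dot_square_norm\<close>)
  define P :: "real^'n^'n" where "P = (\<chi> i j. p j $ i)"
  have col: "column j P = p j" for j by (simp add: P_def column_def vec_eq_iff)
  have SP: "(S ** P) $ i $ j = d j * p j $ i" for i j
  proof -
    have "(S ** P) $ i $ j = (S *v p j) $ i"
      by (simp add: matrix_matrix_mult_def matrix_vector_mult_def P_def)
    then show ?thesis by (simp add: d)
  qed
  have "transpose P ** P = mat 1"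
    using orth by (simp add: vec_eq_iff matrix_mult_dot row_transpose col mat_def
        matrix_matrix_mult_def transpose_def P_def inner_vec_def)
  then have "orthogonal_matrix P" by (simp add: orthogonal_matrix)
  moreover have "(transpose P ** (S ** P)) $ i $ j = (if i = j then d i else 0)" for i j
  proof -
    have "(transpose P ** (S ** P)) $ i $ j = (\<Sum>k\<in>UNIV. p i $ k * (S ** P) $ k $ j)"
      by (simp add: matrix_matrix_mult_def transpose_def P_def)
    also have "\<dots> = d j * (p i \<bullet> p j)"
      by (simp add: SP inner_vec_def sum_distrib_left mult_ac)
    finally show ?thesis by (simp add: orth)
  qed
  ultimately show ?thesis
    by (intro that[of P d]) (simp_all add: vec_eq_iff matrix_mul_assoc)
qed

text \<open>The vector \<open>P *v axis i 1\<close> is the \<open>i\<close>-th column of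
  \<open>P\<close>; in this form bounds on the quadratic form of \<open>M\<close> pass to the
  diagonal entries.\<close>

lemma diagonal_entry_inner:
  fixes M :: "real^'n^'n"
  assumes "transpose P ** M ** P = (\<chi> i j. if i = j then d i else 0)"
  shows "d i = (P *v axis i 1) \<bullet> (M *v (P *v axis i 1))"
proof -
  have "(P *v axis i 1) \<bullet> (M *v (P *v axis i 1)) =
      axis i 1 \<bullet> ((transpose P ** M ** P) *v axis i 1)"
    by (simp add: inner_matrix_vector_transpose flip: matrix_vector_mul_assoc)
  also have "\<dots> = d i"
    by (simp add: assms inner_axis' matrix_vector_mult_basis column_def)
  finally show ?thesis by simp
qed

text \<open>Here \<open>d\<close> lists the eigenvalues. The eigenbasis is hidden; what later
  arguments use is that each eigenvalue is a value of the quadratic form at a unit vector.\<close>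

lemma symmetric_matrix_trace_det:
  fixes S :: "real^'n^'n"
  assumes "transpose S = S"
  obtains d where "trace S = (\<Sum>i\<in>(UNIV :: 'n set). d i)" "det S = (\<Prod>i\<in>UNIV. d i)"
    "\<And>i. \<exists>x. norm x = 1 \<and> d i = x \<bullet> (S *v x)"
proof -
  obtain P d where P: "orthogonal_matrix P"
    and D: "transpose P ** S ** P = (\<chi> i j. if i = j then d i else 0)"
    using symmetric_matrix_diagonalizable[OF assms] .
  have PP: "P ** transpose P = mat 1" using P by (simp add: orthogonal_matrix_def)
  have "trace (transpose P ** S ** P) = trace S"
    by (metis PP matrix_mul_assoc matrix_mul_lid trace_mul_sym)
  then have "trace S = (\<Sum>i\<in>UNIV. d i)" by (simp add: D trace_def)
  moreover have "det P * det P = 1"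
    using PP by (metis det_I det_mul det_transpose)
  then have "det (transpose P ** S ** P) = det S"
    by (simp add: det_mul det_transpose mult_ac)
  then have "det S = (\<Prod>i\<in>UNIV. d i)" by (simp add: D det_diagonal)
  moreover have "norm (P *v axis i 1) = 1" for i
    using P by (simp add: norm_eq_1 inner_matrix_vector_transpose matrix_vector_mul_assoc
        orthogonal_matrix inner_axis')
  ultimately show ?thesis
    using that diagonal_entry_inner[OF D] by blast
qed

section \<open>Traces and determinants\<close>

text \<open>The eigenvalues are positive, being values of the quadratic form, so the inequality of
  arithmetic and geometric means applies to them.\<close>

lemma posdef_matrix_det_le_trace:
  fixes S :: "real^'n^'n"
  assumes "transpose S = S" and pos: "\<And>x. x \<noteq> 0 \<Longrightarrow> x \<bullet> (S *v x) > 0"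
  shows "\<bar>det S\<bar> \<le> (trace S / CARD('n)) ^ CARD('n)" and "trace S \<ge> 0"
proof -
  obtain d where d: "trace S = (\<Sum>i\<in>(UNIV :: 'n set). d i)" "det S = (\<Prod>i\<in>UNIV. d i)"
    "\<And>i. \<exists>x. norm x = 1 \<and> d i = x \<bullet> (S *v x)"
    using symmetric_matrix_trace_det[OF assms(1)] by metis
  have dpos: "d i > 0" for i using d(3)[of i] pos by (metis norm_zero zero_neq_one)
  show "trace S \<ge> 0" unfolding d(1) by (intro sum_nonneg) (simp add: less_imp_le dpos)
  have detpos: "det S > 0" unfolding d(2) by (intro prod_pos) (simp add: dpos)
  have "det S powr (1 / CARD('n)) \<le> trace S / CARD('n)"
    using arith_geom_mean[of UNIV d] dpos unfolding d by (simp add: sum_divide_distrib less_imp_le)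
  then have "(det S powr (1 / CARD('n))) ^ CARD('n) \<le> (trace S / CARD('n)) ^ CARD('n)"
    by (intro power_mono) auto
  then show "\<bar>det S\<bar> \<le> (trace S / CARD('n)) ^ CARD('n)"
    using detpos by (simp add: powr_powr flip: powr_realpow)
qed

text \<open>The eigenvalues of \<open>transpose M ** M\<close> are squared norms of
  \<open>M *v x\<close> at unit vectors \<open>x\<close>, hence at least \<open>r\<^sup>2\<close>,
  and their product is the square of \<open>det M\<close>.\<close>

lemma det_ge_of_norm_ge:
  fixes M :: "real^'n^'n"
  assumes "r \<ge> 0" and "\<And>y. norm (M *v y) \<ge> r * norm y"
  shows "\<bar>det M\<bar> \<ge> r ^ CARD('n)"
proof -
  let ?S = "transpose M ** M"
  obtain d where d: "det ?S = (\<Prod>i\<in>(UNIV :: 'n set). d i)"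
    "\<And>i. \<exists>x. norm x = 1 \<and> d i = x \<bullet> (?S *v x)"
    using symmetric_matrix_trace_det[of ?S] by (metis matrix_transpose_mul transpose_transpose)
  have "d i \<ge> r\<^sup>2" for i
  proof -
    obtain x where x: "norm x = 1" "d i = x \<bullet> (?S *v x)" using d(2) by blast
    then have "d i = (norm (M *v x))\<^sup>2"
      by (simp add: inner_matrix_vector_transpose flip: dot_square_norm matrix_vector_mul_assoc)
    moreover have "norm (M *v x) \<ge> r" using assms(2)[of x] x by simp
    ultimately show ?thesis using assms(1) by (simp add: power_mono)
  qed
  then have "(\<Prod>i\<in>(UNIV::'n set). r\<^sup>2) \<le> det ?S"
    unfolding d(1) by (intro prod_mono) auto
  then have "(r ^ CARD('n))\<^sup>2 \<le> \<bar>det M\<bar>\<^sup>2"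
    by (simp add: det_mul power2_eq_square power_mult_distrib)
  then show ?thesis by (rule power2_le_imp_le) simp
qed

section \<open>Congruence of a positive definite matrix to the identity\<close>

lemma diagonal_matrix_mult:
  fixes a b :: "'n::finite \<Rightarrow> real"
  shows "(\<chi> i j. if i = j then a i else 0) ** (\<chi> i j. if i = j then b i else 0) =
         (\<chi> i j. if i = j then a i * b i else 0)"
proof -
  have "(\<Sum>k\<in>UNIV. (if i = k then a i else 0) * (if k = j then b k else 0)) =
      (\<Sum>k\<in>UNIV. if k = i then (if i = j then a i * b i else 0) else 0)" for i j
    by (intro sum.cong) auto
  then show ?thesis by (simp add: vec_eq_iff matrix_matrix_mult_def)
qed

text \<open>Dividing the \<open>i\<close>-th orthonormal eigenvector by the square root of its
  eigenvalue gives the columns of \<open>V\<close>. The result serves to factor the inverse of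
  \<open>S\<close> as \<open>V ** transpose V\<close>.\<close>

lemma posdef_matrix_congruent_identity:
  fixes S :: "real^'n^'n"
  assumes "transpose S = S" and pos: "\<And>x. x \<noteq> 0 \<Longrightarrow> x \<bullet> (S *v x) > 0"
  obtains V :: "real^'n^'n" where "transpose V ** S ** V = mat 1"
proof -
  obtain P d where P: "orthogonal_matrix P"
    and D: "transpose P ** S ** P = (\<chi> i j. if i = j then d i else 0)"
    using symmetric_matrix_diagonalizable[OF assms(1)] .
  have dpos: "d i > 0" for i
  proof -
    have "P *v axis i 1 \<noteq> 0"
      using P by (metis axis_eq_0_iff matrix_vector_mul_assoc matrix_vector_mul_lid
          matrix_vector_mult_0_right orthogonal_matrix zero_neq_one)
    then show ?thesis using diagonal_entry_inner[OF D, of i] pos by metis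
  qed
  define Q :: "real^'n^'n" where "Q = (\<chi> i j. if i = j then 1 / sqrt (d i) else 0)"
  have "transpose (P ** Q) ** S ** (P ** Q) = transpose Q ** (transpose P ** S ** P) ** Q"
    by (simp add: matrix_transpose_mul matrix_mul_assoc)
  also have "transpose Q = Q" by (auto simp: Q_def transpose_def vec_eq_iff)
  also have "Q ** (transpose P ** S ** P) ** Q = mat 1"
    using dpos less_imp_neq[OF dpos]
    by (simp add: D Q_def diagonal_matrix_mult mat_def vec_eq_iff divide_simps less_imp_le)
  finally show ?thesis using that by blast
qed

text \<open>The columns of \<open>M - mat 1\<close> are \<open>M *v ?e i - ?e i\<close>. The sum of
  their squared norms is controlled by the trace, and the triangle inequality over the coordinates
  of \<open>y\<close> contributes the outer factor \<open>CARD('n)\<close>.\<close>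

lemma near_identity_of_trace:
  fixes M :: "real^'n^'n" and \<delta> :: real
  assumes "0 \<le> \<delta>" and upper: "\<And>y. norm (M *v y) \<le> (1 + \<delta>) * norm y"
    and trace: "trace M \<ge> (1 - \<delta>) * CARD('n)"
  shows "norm (M *v y - y) \<le> CARD('n) * sqrt (CARD('n) * (4 * \<delta> + \<delta>\<^sup>2)) * norm y"
proof -
  let ?n = "real CARD('n)"
  let ?e = "\<lambda>i::'n. axis i (1::real)"
  let ?s = "sqrt (?n * (4 * \<delta> + \<delta>\<^sup>2))"
  have sq: "(norm (M *v ?e i - ?e i))\<^sup>2 \<le> (1 + \<delta>)\<^sup>2 + 1 - 2 * M $ i $ i" for i
  proof -
    have "(norm (M *v ?e i - ?e i))\<^sup>2 = (norm (M *v ?e i))\<^sup>2 + 1 - 2 * M $ i $ i"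
      by (simp add: power2_norm_eq_inner inner_diff_left inner_diff_right inner_axis
          inner_axis' inner_commute matrix_vector_mult_basis column_def)
    moreover have "(norm (M *v ?e i))\<^sup>2 \<le> (1 + \<delta>)\<^sup>2"
      using upper[of "?e i"] by (intro power_mono) auto
    ultimately show ?thesis by simp
  qed
  have col: "norm (M *v ?e i - ?e i) \<le> ?s" for i
  proof -
    \<comment> \<open>A single column is bounded by the whole sum, since the hypothesis bounds the
      trace from below and not the individual diagonal entries.\<close>
    have "(norm (M *v ?e i - ?e i))\<^sup>2 \<le> (\<Sum>i\<in>UNIV. (norm (M *v ?e i - ?e i))\<^sup>2)"
      by (rule member_le_sum) auto
    also have "\<dots> \<le> (\<Sum>i\<in>UNIV. (1 + \<delta>)\<^sup>2 + 1 - 2 * M $ i $ i)"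
      by (intro sum_mono sq)
    also have "\<dots> = ?n * ((1 + \<delta>)\<^sup>2 + 1) - 2 * trace M"
      by (simp add: trace_def sum_subtractf sum_distrib_left)
    also have "\<dots> \<le> ?n * (4 * \<delta> + \<delta>\<^sup>2)"
      using trace by (simp add: algebra_simps power2_eq_square)
    finally show ?thesis by (rule real_le_rsqrt)
  qed
  have "M *v y - y = (M - mat 1) *v y" by (simp add: matrix_vector_mult_diff_rdistrib)
  also have "\<dots> = (\<Sum>i\<in>UNIV. (y $ i) *\<^sub>R (M *v ?e i - ?e i))"
  proof -
    have "column i (M - mat 1) = M *v ?e i - ?e i" for i
      by (simp add: matrix_vector_mult_diff_rdistrib flip: matrix_vector_mult_basis)
    then show ?thesis by (simp add: matrix_mult_sum scalar_mult_eq_scaleR)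
  qed
  also have "norm \<dots> \<le> (\<Sum>i\<in>(UNIV::'n set). norm y * ?s)"
  proof (rule sum_norm_le)
    fix i
    show "norm ((y $ i) *\<^sub>R (M *v ?e i - ?e i)) \<le> norm y * ?s"
      using component_le_norm_cart[of y i] col[of i] by (auto intro: mult_mono)
  qed
  finally show ?thesis by (simp add: mult_ac)
qed

section \<open>Comparison of two positive operators through their matrices\<close>

lemma positive_operator_matrix:
  fixes A :: "real^'n \<Rightarrow> real^'n"
  assumes "positive_operator A"
  shows "A = (*v) (matrix A)" and "transpose (matrix A) = matrix A"
    and "\<And>x. x \<noteq> 0 \<Longrightarrow> x \<bullet> (matrix A *v x) > 0"
proof -
  have lin: "linear A" and sym: "\<And>x y. A x \<bullet> y = x \<bullet> A y"
    and pos: "\<And>x. x \<noteq> 0 \<Longrightarrow> A x \<bullet> x > 0"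
    using assms by (auto simp: positive_operator_def)
  show eq: "A = (*v) (matrix A)" using lin by simp
  then have "\<And>x. A x = matrix A *v x" by metis
  then show "\<And>x. x \<noteq> 0 \<Longrightarrow> x \<bullet> (matrix A *v x) > 0" using pos by (metis inner_commute)
  have "matrix A $ j $ i = matrix A $ i $ j" for i j
    using sym[of "axis i 1" "axis j 1"] by (simp add: matrix_def inner_axis inner_axis')
  then show "transpose (matrix A) = matrix A" by (simp add: vec_eq_iff transpose_def)
qed

lemma positive_operators_near:
  fixes A B :: "real^'n \<Rightarrow> real^'n" and \<delta> :: real
  assumes A: "positive_operator A" and B: "positive_operator B" and \<delta>: "0 \<le> \<delta>" "\<delta> \<le> 1"
    and near: "\<And>x. \<bar>norm (A x) - norm (B x)\<bar> \<le> \<delta> * norm (B x)"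
  shows "norm (A x - B x) \<le> CARD('n) * sqrt (CARD('n) * (4 * \<delta> + \<delta>\<^sup>2)) * norm (B x)"
proof -
  let ?A = "matrix A" and ?B = "matrix B"
  note mA = positive_operator_matrix[OF A] and mB = positive_operator_matrix[OF B]
  have Ax: "A x = ?A *v x" and Bx: "B x = ?B *v x" for x using mA(1) mB(1) by metis+
  obtain V :: "real^'n^'n" where V: "transpose V ** ?B ** V = mat 1"
    using posdef_matrix_congruent_identity[OF mB(2,3)] .
  \<comment> \<open>A one-sided inverse of a square matrix is two-sided, so
    \<open>transpose V\<close> can move to the right end; thus \<open>V ** transpose V\<close> is
    the inverse of \<open>?B\<close>.\<close>
  have BVV: "?B ** (V ** transpose V) = mat 1"
    using V by (metis matrix_left_right_inverse matrix_mul_assoc)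
  then have VVB: "(V ** transpose V) ** ?B = mat 1"
    by (metis matrix_left_right_inverse)
  define T where "T = ?A ** (V ** transpose V)"
  have T: "T *v (B x) = A x" for x
    using matrix_mul_assoc[of ?A "V ** transpose V" ?B]
    by (simp add: T_def Ax Bx VVB matrix_vector_mul_assoc)
  \<comment> \<open>Every \<open>y\<close> has the form \<open>B x\<close>, so the hypothesis on
    \<open>A x\<close> and \<open>B x\<close> becomes an estimate of \<open>T *v y\<close> against
    \<open>y\<close>.\<close>
  have surj: "\<exists>x. y = B x" for y
    by (rule exI[of _ "(V ** transpose V) *v y"]) (simp add: Bx BVV matrix_vector_mul_assoc)
  have upper: "norm (T *v y) \<le> (1 + \<delta>) * norm y" for y
    using surj[of y] near by (auto simp: T algebra_simps abs_le_iff)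
  have lower: "(1 - \<delta>) * norm y \<le> norm (T *v y)" for y
  proof -
    obtain x where "y = B x" using surj by blast
    then show ?thesis using near[of x] by (simp add: T algebra_simps abs_le_iff)
  qed
  \<comment> \<open>\<open>T\<close> itself may fail to be symmetric. \<open>S\<close> is positive
    definite as a congruent of \<open>?A\<close>, and it shares trace and determinant with
    \<open>T\<close> by cyclicity and multiplicativity.\<close>
  define S where "S = transpose V ** ?A ** V"
  have "transpose S = S"
    by (simp add: S_def matrix_transpose_mul mA(2) matrix_mul_assoc)
  moreover have "x \<bullet> (S *v x) > 0" if "x \<noteq> 0" for x
  proof -
    have "V *v x \<noteq> 0"
      using V that by (metis matrix_vector_mul_assoc matrix_vector_mul_lid matrix_vector_mult_0_right)
    then have "(V *v x) \<bullet> (?A *v (V *v x)) > 0" by (rule mA(3))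
    then show ?thesis
      by (simp add: S_def inner_matrix_vector_transpose flip: matrix_vector_mul_assoc)
  qed
  ultimately have S: "\<bar>det S\<bar> \<le> (trace S / CARD('n)) ^ CARD('n)" "trace S \<ge> 0"
    using posdef_matrix_det_le_trace by blast+
  have "trace S = trace T"
    unfolding S_def T_def by (metis matrix_mul_assoc trace_mul_sym)
  moreover have "det S = det T"
    by (simp add: S_def T_def det_mul mult_ac)
  moreover have "(1 - \<delta>) ^ CARD('n) \<le> \<bar>det T\<bar>"
    using \<delta> lower by (intro det_ge_of_norm_ge) auto
  ultimately have "(1 - \<delta>) ^ CARD('n) \<le> (trace T / CARD('n)) ^ CARD('n)" "trace T \<ge> 0"
    using S by auto
  \<comment> \<open>Taking roots uses \<open>trace T \<ge> 0\<close>: an even power could otherwise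
    hide a negative base.\<close>
  then have "1 - \<delta> \<le> trace T / CARD('n)"
    by (metis (no_types) divide_nonneg_nonneg of_nat_0_le_iff power_mono_iff zero_less_card_finite
        linear order_trans)
  then have "trace T \<ge> (1 - \<delta>) * CARD('n)" by (simp add: field_simps)
  from near_identity_of_trace[OF \<delta>(1) upper this, of "B x"] show ?thesis by (simp add: T)
qed

theorem proposition5p1:
  fixes \<epsilon> :: real
  assumes "\<epsilon> > 0"
  shows "\<exists>\<delta>>0. \<forall>A B :: real ^ 'm \<Rightarrow> real ^ 'm.
           positive_operator A \<longrightarrow> positive_operator B \<longrightarrow>
           (\<forall>x. \<bar>norm (A x) - norm (B x)\<bar> \<le> \<delta> * norm (B x)) \<longrightarrow>
           (\<forall>x. norm (A x - B x) \<le> \<epsilon> * norm (B x))"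
proof -
  let ?n = "real CARD('m)"
  \<comment> \<open>The bound 1 gives \<open>\<delta>\<^sup>2 \<le> \<delta>\<close>, so the
    radicand is at most \<open>?n * (5 * \<delta>)\<close>; the other entry makes this at most
    \<open>(\<epsilon> / ?n)\<^sup>2\<close>.\<close>
  define \<delta> where "\<delta> = min 1 ((\<epsilon> / ?n)\<^sup>2 / (5 * ?n))"
  have \<delta>: "0 < \<delta>" "\<delta> \<le> 1" using assms by (auto simp: \<delta>_def)
  have "4 * \<delta> + \<delta>\<^sup>2 \<le> 5 * \<delta>" using \<delta> by (simp add: power2_eq_square mult_left_le)
  then have "?n * (4 * \<delta> + \<delta>\<^sup>2) \<le> ?n * (5 * \<delta>)" by (intro mult_left_mono) auto
  also have "\<dots> \<le> (\<epsilon> / ?n)\<^sup>2"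
  proof -
    have "\<delta> \<le> (\<epsilon> / ?n)\<^sup>2 / (5 * ?n)" by (simp add: \<delta>_def)
    then have "\<delta> * (5 * ?n) \<le> (\<epsilon> / ?n)\<^sup>2" by (subst (asm) pos_le_divide_eq) auto
    then show ?thesis by (simp add: mult_ac)
  qed
  finally have "sqrt (?n * (4 * \<delta> + \<delta>\<^sup>2)) \<le> \<epsilon> / ?n"
    using assms by (intro real_le_lsqrt) auto
  then have const: "?n * sqrt (?n * (4 * \<delta> + \<delta>\<^sup>2)) \<le> \<epsilon>"
    by (simp add: field_simps)
  show ?thesis
  proof (intro exI[of _ \<delta>] conjI allI impI \<delta>(1))
    fix A B :: "real ^ 'm \<Rightarrow> real ^ 'm" and x
    assume "positive_operator A" "positive_operator B"
      "\<forall>x. \<bar>norm (A x) - norm (B x)\<bar> \<le> \<delta> * norm (B x)"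
    then have "norm (A x - B x) \<le> ?n * sqrt (?n * (4 * \<delta> + \<delta>\<^sup>2)) * norm (B x)"
      using \<delta> by (intro positive_operators_near) auto
    also have "\<dots> \<le> \<epsilon> * norm (B x)" by (intro mult_right_mono const) auto
    finally show "norm (A x - B x) \<le> \<epsilon> * norm (B x)" .
  qed
qed

end
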